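(* Let $r\in(0,1)$, let $P_r=M_r+N_r$ be the operator on $L^2(m)$ and $\{e_n\}_{n\ge 0}$ the Laguerre polynomials described in the context, and let $$a_{kn}^r:=\frac{1}{k+1}\,(P_r e_n,e_k),\qquad k,n\ge 0,$$ where $(\cdot,\cdot)$ is the inner product of $L^2(m)$. Then for all $r\in(0,1)$ and all integers $k,n\ge 0$, $$ \begin{aligned} a_{kn}^r = \ & \binom{n+k+1}{n}\, \frac{(2-r)\,r^{k}}{2^{n+k+2}}\; {}_2F_1\!\left(-k,-n;-k-n-1;\frac{2(r-1)}{r}\right)\\ &+\sum_{l=0}^{n}(-1)^{l}\, \binom{n+1}{n-l}\, \binom{l+k+1}{l}\, \frac{(2-r)\,r^{k}}{2^{l+k+2}}\; {}_2F_1\!\left(-k,-l;-k-l-1;\frac{2(r-1)}{r}\right). \end{aligned} $$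
   Context: Let $m$ be the measure on $\mathbb{R}^+=(0,\infty)$ given by $dm(t)=t e^{-t}\,dt$, and let $L^2(m)=L^2(\mathbb{R}^+,m)$ with inner product $(\varphi_1,\varphi_2)=\int_0^\infty \varphi_1(t)\,\overline{\varphi_2(t)}\,dm(t)$. For $n\ge 0$ let $e_n$ be the (generalized) Laguerre polynomial $$e_n(t)=\sum_{j=0}^n \binom{n+1}{n-j}\frac{(-t)^j}{j!}.$$ The family $\{e_n\}_{n\ge0}$ is a complete orthogonal system in $L^2(m)$ with $(e_n,e_n)=n+1$. For $r\in(0,1)$ put $\rho=2-r$ and define operators $M_r,N_r:L^2(m)\to L^2(m)$ by $$(M_r\varphi)(t)=\frac1\rho\,e^{-\frac{r}{\rho}t}\,\varphi\!\left(\frac t\rho\right),\qquad (N_r\varphi)(t)=\frac1\rho\,e^{\frac{1-r}{\rho}t}\int_0^\infty J_1\!\left(2\sqrt{st/\rho}\right)\sqrt{\frac{\rho}{st}}\;\varphi(s)\,dm(s),$$ where $J_1$ is the Bessel function of the first kind of order $1$. Set $P_r=M_r+N_r$. ${}_2F_1(a,b;c;z)=\sum_{j\ge0}\frac{(a)_j(b)_j}{(c)_j}\frac{z^j}{j!}$ is the Gauss hypergeometric function, with $(a)_j=a(a+1)\cdots(a+j-1)$ the Pochhammer symbol. For $a=-k$, $b=-l$, $c=-k-l-1$ with integers $k,l\ge0$, it denotes the terminating sum over $0\le j\le \min(k,l)$, in which no denominator $(c)_j$ vanishes. *)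

theory Defs
  imports "HOL-Analysis.Analysis"
begin

text \<open>The measure $dm(t) = t e^{-t}\,dt$ on $(0,\infty)$. Elements of $L^2(m)$ are represented by
  functions \<^typ>\<open>real \<Rightarrow> complex\<close>, only their values on $(0,\infty)$ being relevant.\<close>

definition m_measure :: "real measure" where
  "m_measure = density (restrict_space lborel {0<..}) (\<lambda>t. ennreal (t * exp (- t)))"

definition m_inner :: "(real \<Rightarrow> complex) \<Rightarrow> (real \<Rightarrow> complex) \<Rightarrow> complex" where
  "m_inner \<phi>1 \<phi>2 = (\<integral>t. \<phi>1 t * cnj (\<phi>2 t) \<partial>m_measure)"

text \<open>The generalized Laguerre polynomial $L_n^{(1)}$, as a complex-valued function.\<close>

definition laguerre_e :: "nat \<Rightarrow> real \<Rightarrow> complex" where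
  "laguerre_e n t = complex_of_real (\<Sum>j=0..n. real ((n + 1) choose (n - j)) * (- t) ^ j / fact j)"

text \<open>The Bessel function of the first kind $J_\nu$ of integer order $\nu \ge 0$ on the real line.\<close>

definition bessel_J :: "nat \<Rightarrow> real \<Rightarrow> real" where
  "bessel_J \<nu> x = (\<Sum>j. (- 1) ^ j / (fact j * fact (j + \<nu>)) * (x / 2) ^ (2 * j + \<nu>))"

definition M_op :: "real \<Rightarrow> (real \<Rightarrow> complex) \<Rightarrow> real \<Rightarrow> complex" where
  "M_op r \<phi> t =
     (let \<rho> = 2 - r in complex_of_real (1 / \<rho> * exp (- (r / \<rho>) * t)) * \<phi> (t / \<rho>))"

definition N_op :: "real \<Rightarrow> (real \<Rightarrow> complex) \<Rightarrow> real \<Rightarrow> complex" where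
  "N_op r \<phi> t =
     (let \<rho> = 2 - r in
        complex_of_real (1 / \<rho> * exp ((1 - r) / \<rho> * t)) *
        (\<integral>s. complex_of_real (bessel_J 1 (2 * sqrt (s * t / \<rho>)) * sqrt (\<rho> / (s * t))) * \<phi> s \<partial>m_measure))"

definition P_op :: "real \<Rightarrow> (real \<Rightarrow> complex) \<Rightarrow> real \<Rightarrow> complex" where
  "P_op r \<phi> t = M_op r \<phi> t + N_op r \<phi> t"

definition a_coeff :: "real \<Rightarrow> nat \<Rightarrow> nat \<Rightarrow> complex" where
  "a_coeff r k n = 1 / (of_nat k + 1) * m_inner (P_op r (laguerre_e n)) (laguerre_e k)"

definition hyp2F1 :: "real \<Rightarrow> real \<Rightarrow> real \<Rightarrow> real \<Rightarrow> real" where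
  "hyp2F1 a b c z = eval_fps (fps_hypergeo [a, b] [c] 1) z"

lemma hyp2F1_series:
  "hyp2F1 a b c z =
     (\<Sum>j. pochhammer a j * pochhammer b j / pochhammer c j * z ^ j / fact j)"
  by (simp add: hyp2F1_def eval_fps_def)

text \<open>For $c = -k-l-1$ the coefficients with $j > k + l + 1$ have a vanishing denominator; the
  convention $x/0 = 0$ makes them vanish, so that the series is the terminating sum.\<close>

lemma hyp2F1_terminating:
  "hyp2F1 (- real k) (- real l) (- real k - real l - 1) z =
     (\<Sum>j=0..min k l. pochhammer (- real k) j * pochhammer (- real l) j
        / pochhammer (- real k - real l - 1) j * z ^ j / fact j)"
proof -
  have "pochhammer (- real k) j * pochhammer (- real l) j = 0" if "j \<notin> {0..min k l}" for j
    using that by (auto simp: pochhammer_of_nat_eq_0_lemma)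
  then show ?thesis
    unfolding hyp2F1_series by (intro suminf_finite) auto
qed

lemma hyp2F1_terminating_denominator:
  assumes "j \<le> min k l"
  shows "pochhammer (- real k - real l - 1) j \<noteq> 0"
  using assms by (auto simp: pochhammer_eq_0_iff)

end

theory Submission
  imports Defs "HOL-Probability.Distributions"
begin

text \<open>
  Write $\rho = 2 - r$ and $x = t / \rho$. The Hankel transform maps $e_n$ to $e^{-x} x^n / n!$, so
  $P_r e_n (t) = \rho^{-1} e^{-r x} (e_n(x) + x^n / n!)$. Substituting $t = \rho v / 2$ in the inner
  product and using $x^n / n! = \sum_l (-1)^l \binom{n+1}{n-l} e_l(x)$ reduces everything to the
  integrals $\int e_l(v/2)\, e_k(\rho v/2)\, dm(v)$. By the multiplication formula
  $e_n(a v) = \sum_i \binom{n+1}{i+1} a^i (1-a)^{n-i} e_i(v)$ and orthogonality, such an integral is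
  $2^{-k-l} \sum_i (i+1) \binom{l+1}{i+1} \binom{k+1}{i+1} \rho^i r^{k-i}$. Expanding
  $\rho^i = (2(1-r) + r)^i$ and summing over $i$ by Vandermonde gives the hypergeometric polynomial.
\<close>

section \<open>Binomial sums\<close>

text \<open>Trinomial revision turns the product of the two binomials into
  \<open>(Suc n choose Suc j) * (n - j choose (i - j))\<close>, after which the binomial theorem
  applies to a and b. This is the composition law behind the dilation, inversion and orthogonality
  of the Laguerre polynomials.\<close>

lemma sum_binomial_chain:
  fixes a b :: real
  assumes "j \<le> n"
  shows "(\<Sum>i\<le>n. real (Suc n choose Suc i) * real (Suc i choose Suc j) * a ^ i * b ^ (n - i)) =
         real (Suc n choose Suc j) * a ^ j * (a + b) ^ (n - j)"
proof -
  obtain d where n: "n = j + d"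
    using assms le_Suc_ex by blast
  have "(\<Sum>i\<le>n. real (Suc n choose Suc i) * real (Suc i choose Suc j) * a ^ i * b ^ (n - i)) =
        (\<Sum>i\<in>{j..j + d}. real (Suc n choose Suc i) * real (Suc i choose Suc j) * a ^ i * b ^ (n - i))"
    using n by (intro sum.mono_neutral_right) (auto simp: not_le binomial_eq_0 simp del: binomial_Suc_Suc)
  also have "\<dots> = (\<Sum>m\<in>{..d}. real (Suc n choose Suc (j + m)) * real (Suc (j + m) choose Suc j) *
                     a ^ (j + m) * b ^ (d - m))"
    unfolding n by (rule sum.reindex_bij_witness[of _ "\<lambda>m. j + m" "\<lambda>i. i - j"])
      (auto simp del: binomial_Suc_Suc simp: add.commute)
  also have "\<dots> = (\<Sum>m\<le>d. real (Suc n choose Suc j) * a ^ j * (real (d choose m) * a ^ m * b ^ (d - m)))"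
  proof (intro sum.cong refl)
    fix m assume "m \<in> {..d}"
    then have "(Suc n choose Suc (j + m)) * (Suc (j + m) choose Suc j) = (Suc n choose Suc j) * (d choose m)"
      using choose_mult[of "Suc j" "Suc (j + m)" "Suc n"] n by (simp del: binomial_Suc_Suc)
    then have "real (Suc n choose Suc (j + m)) * real (Suc (j + m) choose Suc j) =
               real (Suc n choose Suc j) * real (d choose m)"
      by (metis of_nat_mult)
    then show "real (Suc n choose Suc (j + m)) * real (Suc (j + m) choose Suc j) * a ^ (j + m) * b ^ (d - m) =
       real (Suc n choose Suc j) * a ^ j * (real (d choose m) * a ^ m * b ^ (d - m))"
      by (simp add: power_add del: binomial_Suc_Suc)
  qed
  also have "\<dots> = real (Suc n choose Suc j) * a ^ j * (a + b) ^ (n - j)"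
    using n by (simp add: binomial_ring sum_distrib_left del: binomial_Suc_Suc)
  finally show ?thesis .
qed

text \<open>Pascal's rule combined with an index shift. Up to sign the left side is a finite
  difference of f of order i + 1, and one of the differences is carried out explicitly on the
  right.\<close>

lemma sum_alternating_binomial_Suc:
  fixes f :: "nat \<Rightarrow> real"
  shows "(\<Sum>m\<le>Suc i. (-1) ^ m * real (Suc i choose m) * f m) =
         (\<Sum>m\<le>i. (-1) ^ m * real (i choose m) * (f m - f (Suc m)))"
proof -
  have "(\<Sum>m\<le>Suc i. (-1) ^ m * real (Suc i choose m) * f m) =
        f 0 + (\<Sum>m\<le>i. (-1) ^ Suc m * real (i choose Suc m) * f (Suc m)) -
        (\<Sum>m\<le>i. (-1) ^ m * real (i choose m) * f (Suc m))"
    by (subst sum.atMost_Suc_shift) (simp add: sum.distrib sum_subtractf sum_negf algebra_simps)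
  also have "f 0 + (\<Sum>m\<le>i. (-1) ^ Suc m * real (i choose Suc m) * f (Suc m)) =
             (\<Sum>m\<le>Suc i. (-1) ^ m * real (i choose m) * f m)"
    by (subst sum.atMost_Suc_shift) simp
  also have "(\<Sum>m\<le>Suc i. (-1) ^ m * real (i choose m) * f m) = (\<Sum>m\<le>i. (-1) ^ m * real (i choose m) * f m)"
    by simp
  finally show ?thesis
    by (simp add: sum_subtractf algebra_simps del: sum.atMost_Suc binomial_Suc_Suc)
qed

text \<open>Each difference lowers the lower index by one, by Pascal's rule, until it reaches 0 and
  the next difference vanishes. The offset a has to vary in the induction because differencing also
  calls on \<open>Suc a\<close>.\<close>

lemma sum_alternating_binomial_shifted:
  "(\<Sum>m\<le>i. (-1) ^ m * real (i choose m) * real ((m + a) choose j)) =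
   (if i \<le> j then (-1) ^ i * real (a choose (j - i)) else 0)"
proof (induction i arbitrary: a)
  case (Suc i)
  have "(\<Sum>m\<le>Suc i. (-1) ^ m * real (Suc i choose m) * real ((m + a) choose j)) =
        (\<Sum>m\<le>i. (-1) ^ m * real (i choose m) * real ((m + a) choose j)) -
        (\<Sum>m\<le>i. (-1) ^ m * real (i choose m) * real ((m + Suc a) choose j))"
    by (subst sum_alternating_binomial_Suc) (simp add: right_diff_distrib sum_subtractf)
  also have "\<dots> = (if i \<le> j then (-1) ^ i * (real (a choose (j - i)) - real (Suc a choose (j - i))) else 0)"
    by (simp only: Suc.IH) (simp add: right_diff_distrib)
  also have "\<dots> = (if Suc i \<le> j then (-1) ^ Suc i * real (a choose (j - Suc i)) else 0)"
  \<comment> \<open>In the other case either i = j, where both binomials are 1 and cancel, or i > j,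
    where the value is already 0.\<close>
  proof (cases "Suc i \<le> j")
    case True
    then obtain d where "j = Suc i + d" using le_Suc_ex by blast
    then show ?thesis by simp
  qed (auto simp: not_le less_Suc_eq_le)
  finally show ?case .
qed simp

section \<open>Algebra of the Laguerre polynomials\<close>

text \<open>Throughout, $\binom{n+1}{n-j}$ is written as $\binom{n+1}{j+1}$, which vanishes for $j > n$
  without any truncated subtraction.\<close>

definition laguerre :: "nat \<Rightarrow> real \<Rightarrow> real" where
  "laguerre n x = (\<Sum>j\<le>n. real (Suc n choose Suc j) * (- x) ^ j / fact j)"

lemma laguerre_e_eq: "laguerre_e n t = complex_of_real (laguerre n t)"
proof -
  have "(n + 1 choose (n - j)) = (Suc n choose Suc j)" if "j \<le> n" for j
    using that binomial_symmetric[of "Suc j" "Suc n"] by (simp del: binomial_Suc_Suc)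
  then show ?thesis
    unfolding laguerre_e_def laguerre_def
    by (intro arg_cong[where f = complex_of_real] sum.cong)
      (auto simp del: binomial_Suc_Suc)
qed

text \<open>The added terms have vanishing binomials. A summation range independent of i is what
  allows double sums to be swapped.\<close>

lemma laguerre_eq_extended_sum:
  assumes "i \<le> n"
  shows "laguerre i x = (\<Sum>j\<le>n. real (Suc i choose Suc j) * (- x) ^ j / fact j)"
  unfolding laguerre_def using assms
  by (intro sum.mono_neutral_left) (auto simp: not_le binomial_eq_0 simp del: binomial_Suc_Suc)

text \<open>Both the multiplication formula ($b = 1 - a$) and the inversion formula ($a = -1$, $b = 1$)
  are instances.\<close>

lemma sum_laguerre:
  "(\<Sum>i\<le>n. real (Suc n choose Suc i) * a ^ i * b ^ (n - i) * laguerre i x) =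
   (\<Sum>j\<le>n. real (Suc n choose Suc j) * a ^ j * (a + b) ^ (n - j) * ((- x) ^ j / fact j))"
proof -
  have "(\<Sum>i\<le>n. real (Suc n choose Suc i) * a ^ i * b ^ (n - i) * laguerre i x) =
        (\<Sum>i\<le>n. \<Sum>j\<le>n. real (Suc n choose Suc i) * a ^ i * b ^ (n - i) *
           (real (Suc i choose Suc j) * (- x) ^ j / fact j))"
    by (intro sum.cong refl) (simp add: laguerre_eq_extended_sum[of _ n] sum_distrib_left del: binomial_Suc_Suc)
  also have "\<dots> = (\<Sum>j\<le>n. \<Sum>i\<le>n. real (Suc n choose Suc i) * a ^ i * b ^ (n - i) *
           (real (Suc i choose Suc j) * (- x) ^ j / fact j))"
    by (rule sum.swap)
  also have "\<dots> = (\<Sum>j\<le>n. (\<Sum>i\<le>n. real (Suc n choose Suc i) * real (Suc i choose Suc j) * a ^ i * b ^ (n - i)) *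
           ((- x) ^ j / fact j))"
    by (simp add: sum_distrib_left sum_distrib_right mult_ac del: binomial_Suc_Suc)
  also have "\<dots> = (\<Sum>j\<le>n. real (Suc n choose Suc j) * a ^ j * (a + b) ^ (n - j) * ((- x) ^ j / fact j))"
    by (intro sum.cong refl, subst sum_binomial_chain) (auto simp del: binomial_Suc_Suc)
  finally show ?thesis .
qed

lemma laguerre_mult:
  "laguerre n (a * x) = (\<Sum>i\<le>n. real (Suc n choose Suc i) * a ^ i * (1 - a) ^ (n - i) * laguerre i x)"
proof -
  have "(- (a * x)) ^ j = a ^ j * (- x) ^ j" for j
    by (metis mult_minus_right power_mult_distrib)
  then show ?thesis
    unfolding sum_laguerre by (simp add: laguerre_def mult.assoc del: binomial_Suc_Suc)
qed

lemma power_eq_sum_laguerre: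
  "x ^ n / fact n = (\<Sum>l\<le>n. (-1) ^ l * real (Suc n choose Suc l) * laguerre l x)"
proof -
  have "(\<Sum>l\<le>n. (-1) ^ l * real (Suc n choose Suc l) * laguerre l x) =
        (\<Sum>j\<le>n. real (Suc n choose Suc j) * (-1) ^ j * 0 ^ (n - j) * ((- x) ^ j / fact j))"
    using sum_laguerre[of n "-1" 1 x] by (simp add: mult.commute del: binomial_Suc_Suc)
  \<comment> \<open>The instance has a + b = 0, so only the term j = n survives, where
    \<open>0 ^ 0 = 1\<close>.\<close>
  also have "\<dots> = (\<Sum>j\<in>{n}. real (Suc n choose Suc j) * (-1) ^ j * 0 ^ (n - j) * ((- x) ^ j / fact j))"
    by (rule sum.mono_neutral_right) (auto simp del: binomial_Suc_Suc)
  also have "\<dots> = x ^ n / fact n"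
    by (simp flip: power_mult_distrib)
  finally show ?thesis ..
qed

section \<open>Integration against the measure m\<close>

lemma space_m_measure [simp]: "space m_measure = {0<..}"
  by (simp add: m_measure_def space_restrict_space)

lemma borel_measurable_m_measure [measurable (raw)]:
  "f \<in> borel_measurable borel \<Longrightarrow> f \<in> borel_measurable m_measure"
  by (simp add: m_measure_def measurable_restrict_space1)

text \<open>The restriction to the half-line becomes an indicator on the whole line, where Gamma
  integrals and affine substitution for Lebesgue measure are available.\<close>

lemma
  fixes f :: "real \<Rightarrow> real"
  assumes [measurable]: "f \<in> borel_measurable borel"
  shows integral_m_measure:
      "(\<integral>t. f t \<partial>m_measure) = (\<integral>t. indicator {0<..} t * (t * exp (- t) * f t) \<partial>lborel)"
    and integrable_m_measure:
      "integrable m_measure f \<longleftrightarrow> integrable lborel (\<lambda>t. indicator {0<..} t * (t * exp (- t) * f t))"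
proof -
  have AE: "AE t in restrict_space lborel {0<..}. 0 \<le> t * exp (- t :: real)"
    by (intro AE_I2) (auto simp: space_restrict_space)
  have f: "f \<in> borel_measurable (restrict_space lborel {0<..})"
       "(\<lambda>t. t * exp (- t :: real)) \<in> borel_measurable (restrict_space lborel {0<..})"
    by (auto intro: measurable_restrict_space1)
  show "(\<integral>t. f t \<partial>m_measure) = (\<integral>t. indicator {0<..} t * (t * exp (- t) * f t) \<partial>lborel)"
    unfolding m_measure_def
    by (subst integral_density[OF f AE], subst integral_restrict_space) auto
  show "integrable m_measure f \<longleftrightarrow> integrable lborel (\<lambda>t. indicator {0<..} t * (t * exp (- t) * f t))"
    unfolding m_measure_def
    by (subst integrable_density[OF f AE], subst integrable_restrict_space) auto
qed

lemma has_bochner_integral_m_measure_power: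
  "has_bochner_integral m_measure (\<lambda>t. t ^ j) (fact (Suc j))"
proof -
  have "has_bochner_integral lborel (\<lambda>t. indicator {0<..} t * (t * exp (- t) * t ^ j)) (fact (Suc j) :: real)"
  proof (rule has_bochner_integral_nn_integral)
    \<comment> \<open>The density supplies one extra factor t, hence the Gamma integral of
      \<open>t ^ Suc j\<close>. Including the endpoint 0 is harmless because this power vanishes
      there.\<close>
    have "(\<integral>\<^sup>+t. ennreal (indicator {0<..} t * (t * exp (- t) * t ^ j)) \<partial>lborel) =
          (\<integral>\<^sup>+t. ennreal (t ^ Suc j * exp (- t)) * indicator {0..} t \<partial>lborel)"
      by (intro nn_integral_cong) (auto simp: indicator_def mult_ac)
    also have "\<dots> = ennreal (fact (Suc j))"
      by (subst nn_intergal_power_times_exp_Ici) (simp del: fact_Suc)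
    finally show "(\<integral>\<^sup>+t. ennreal (indicator {0<..} t * (t * exp (- t) * t ^ j)) \<partial>lborel) =
       ennreal (fact (Suc j))" .
  qed (auto simp: indicator_def)
  then show ?thesis
    by (simp add: has_bochner_integral_iff integral_m_measure integrable_m_measure)
qed

lemmas integrable_m_measure_power [simp, intro] =
  has_bochner_integral_m_measure_power[THEN integrable.intros]

lemmas integral_m_measure_power = has_bochner_integral_m_measure_power[THEN has_bochner_integral_integral_eq]

text \<open>The exponential factor replaces exp(-t) in the density by exp(-a t), so substituting a t
  is possible. One factor 1/a comes from dt, the other from the weight t.\<close>

lemma integral_m_measure_dilate:
  fixes f :: "real \<Rightarrow> real"
  assumes [measurable]: "f \<in> borel_measurable borel" and "0 < a"
  shows "(\<integral>t. exp ((1 - a) * t) * f (a * t) \<partial>m_measure) = (\<integral>t. f t \<partial>m_measure) / a\<^sup>2"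
proof -
  define g where "g = (\<lambda>t. indicator {0<..} t * (t * exp (- t) * f t))"
  have "(\<integral>t. exp ((1 - a) * t) * f (a * t) \<partial>m_measure) = (\<integral>t. g (a * t) / a \<partial>lborel)"
    using \<open>0 < a\<close>
    by (subst integral_m_measure)
      (auto intro!: Bochner_Integration.integral_cong
        simp: g_def indicator_def zero_less_mult_iff field_simps simp flip: exp_add)
  moreover have "(\<integral>t. f t \<partial>m_measure) = a * (\<integral>t. g (a * t) \<partial>lborel)"
    using lborel_integral_real_affine[of a g 0] \<open>0 < a\<close> by (simp add: integral_m_measure g_def)
  ultimately show ?thesis
    using \<open>0 < a\<close> by (simp add: power2_eq_square)
qed

section \<open>Moments and orthogonality of Laguerre polynomials\<close>

lemma power_mult_laguerre_expand:
  "t ^ j * laguerre i t = (\<Sum>m\<le>i. (real (Suc i choose Suc m) * (-1) ^ m / fact m) * t ^ (m + j))"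
  unfolding laguerre_def
  by (simp add: sum_distrib_left power_add power_minus[of t] mult_ac del: binomial_Suc_Suc)

lemma integrable_power_mult_laguerre: "integrable m_measure (\<lambda>t. t ^ j * laguerre i t)"
  unfolding power_mult_laguerre_expand by (simp del: binomial_Suc_Suc)

text \<open>Absorption, \<open>Suc m * (Suc i choose Suc m) = Suc i * (i choose m)\<close>, turns
  the sum of moments into an i-th alternating difference of \<open>(m + Suc j) choose j\<close>. In
  particular the integral vanishes for j < i.\<close>

lemma integral_power_mult_laguerre:
  "(\<integral>t. t ^ j * laguerre i t \<partial>m_measure) = (-1) ^ i * real (Suc i) * fact j * real (Suc j choose Suc i)"
proof -
  have "(\<integral>t. t ^ j * laguerre i t \<partial>m_measure) =
        (\<Sum>m\<le>i. real (Suc i choose Suc m) * (-1) ^ m / fact m * fact (Suc (m + j)))"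
    unfolding power_mult_laguerre_expand
    by (subst Bochner_Integration.integral_sum)
      (auto simp: integral_m_measure_power simp del: binomial_Suc_Suc fact_Suc)
  also have "\<dots> = (\<Sum>m\<le>i. real (Suc i) * fact j * ((-1) ^ m * real (i choose m) * real ((m + Suc j) choose j)))"
  proof (intro sum.cong refl)
    fix m
    have "real (Suc m) * real (Suc i choose Suc m) = real (Suc i) * real (i choose m)"
      by (metis Suc_times_binomial of_nat_mult)
    moreover have "fact (Suc (m + j)) = fact j * fact (Suc m) * real ((m + Suc j) choose j)"
      using binomial_fact[of j "m + Suc j", where ?'a = real] by (simp del: fact_Suc)
    ultimately show "real (Suc i choose Suc m) * (-1) ^ m / fact m * fact (Suc (m + j)) =
       real (Suc i) * fact j * ((-1) ^ m * real (i choose m) * real ((m + Suc j) choose j))"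
      by (simp add: fact_Suc[of m] field_simps del: binomial_Suc_Suc of_nat_Suc)
  qed
  also have "\<dots> = real (Suc i) * fact j * (if i \<le> j then (-1) ^ i * real (Suc j choose (j - i)) else 0)"
    by (simp only: sum_distrib_left[symmetric] sum_alternating_binomial_shifted)
  also have "\<dots> = (-1) ^ i * real (Suc i) * fact j * real (Suc j choose Suc i)"
    using binomial_symmetric[of "Suc i" "Suc j"]
    by (auto simp: not_le binomial_eq_0 simp del: binomial_Suc_Suc)
  finally show ?thesis .
qed

lemma laguerre_mult_laguerre_expand:
  "laguerre i t * laguerre k t = (\<Sum>j\<le>k. (-1) ^ j * real (Suc k choose Suc j) / fact j * (t ^ j * laguerre i t))"
  unfolding laguerre_def[of k] by (simp add: sum_distrib_left power_minus[of t] mult_ac del: binomial_Suc_Suc)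

lemma integrable_laguerre_mult_laguerre: "integrable m_measure (\<lambda>t. laguerre i t * laguerre k t)"
  unfolding laguerre_mult_laguerre_expand by (simp add: integrable_power_mult_laguerre del: binomial_Suc_Suc)

lemma integral_laguerre_mult_laguerre:
  "(\<integral>t. laguerre i t * laguerre k t \<partial>m_measure) = (if i = k then real (Suc i) else 0)"
proof -
  have "(\<integral>t. laguerre i t * laguerre k t \<partial>m_measure) =
        (\<Sum>j\<le>k. (-1) ^ j * real (Suc k choose Suc j) / fact j *
          ((-1) ^ i * real (Suc i) * fact j * real (Suc j choose Suc i)))"
    unfolding laguerre_mult_laguerre_expand
    by (subst Bochner_Integration.integral_sum)
      (auto simp: integral_power_mult_laguerre integrable_power_mult_laguerre simp del: binomial_Suc_Suc fact_Suc)
  \<comment> \<open>The sum is put in the shape of \<open>sum_binomial_chain\<close> with a = -1 and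
    b = 1. For i \<le> k it then contains the factor \<open>0 ^ (k - i)\<close>, which is the
    Kronecker delta.\<close>
  also have "\<dots> = (-1) ^ i * real (Suc i) *
     (\<Sum>j\<le>k. real (Suc k choose Suc j) * real (Suc j choose Suc i) * (-1) ^ j * 1 ^ (k - j))"
    by (simp add: sum_distrib_left mult_ac del: binomial_Suc_Suc of_nat_Suc)
  also have "\<dots> = (if i = k then real (Suc i) else 0)"
  proof (cases "i \<le> k")
    case True
    then show ?thesis
      by (subst sum_binomial_chain) (auto simp: power_0_left simp del: binomial_Suc_Suc)
  next
    case False
    then show ?thesis
      by (auto intro!: sum.neutral simp: binomial_eq_0 simp del: binomial_Suc_Suc)
  qed
  finally show ?thesis .
qed

lemma laguerre_dilate_mult_laguerre_dilate_expand:
  "laguerre l (a * t) * laguerre k (b * t) =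
   (\<Sum>j\<le>k. \<Sum>i\<le>l. real (Suc l choose Suc i) * a ^ i * (1 - a) ^ (l - i) *
     (real (Suc k choose Suc j) * b ^ j * (1 - b) ^ (k - j)) * (laguerre i t * laguerre j t))"
  unfolding laguerre_mult[of l] laguerre_mult[of k] sum_product
  by (subst sum.swap) (simp add: mult_ac del: binomial_Suc_Suc)

lemma integrable_laguerre_dilate_mult_laguerre_dilate:
  "integrable m_measure (\<lambda>t. laguerre l (a * t) * laguerre k (b * t))"
  unfolding laguerre_dilate_mult_laguerre_dilate_expand
  by (simp add: integrable_laguerre_mult_laguerre del: binomial_Suc_Suc)

text \<open>The multiplication formula expands both factors and orthogonality keeps the diagonal.
  The range i \<le> k may exceed l, since \<open>Suc l choose Suc i\<close> is then 0.\<close>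

lemma integral_laguerre_dilate_mult_laguerre_dilate:
  "(\<integral>t. laguerre l (a * t) * laguerre k (b * t) \<partial>m_measure) =
   (\<Sum>i\<le>k. real (Suc i) * real (Suc l choose Suc i) * real (Suc k choose Suc i) *
      (a * b) ^ i * (1 - a) ^ (l - i) * (1 - b) ^ (k - i))"
proof -
  have "(\<integral>t. laguerre l (a * t) * laguerre k (b * t) \<partial>m_measure) =
    (\<Sum>j\<le>k. \<Sum>i\<le>l. real (Suc l choose Suc i) * a ^ i * (1 - a) ^ (l - i) *
     (real (Suc k choose Suc j) * b ^ j * (1 - b) ^ (k - j)) * (if i = j then real (Suc i) else 0))"
    unfolding laguerre_dilate_mult_laguerre_dilate_expand
    by (simp add: integrable_laguerre_mult_laguerre integral_laguerre_mult_laguerre del: binomial_Suc_Suc)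
  also have "\<dots> = (\<Sum>i\<le>k. real (Suc i) * real (Suc l choose Suc i) * real (Suc k choose Suc i) *
      (a * b) ^ i * (1 - a) ^ (l - i) * (1 - b) ^ (k - i))"
    by (auto simp: if_distrib power_mult_distrib not_le binomial_eq_0 simp del: binomial_Suc_Suc
      cong: if_cong intro!: sum.cong)
  finally show ?thesis .
qed

section \<open>The hypergeometric polynomial\<close>

text \<open>Absorption of \<open>Suc i\<close> and trinomial revision pull out
  \<open>Suc l * (l choose m)\<close>; reflecting \<open>Suc k choose Suc i\<close> leaves a
  Vandermonde convolution in p = i - m.\<close>

lemma sum_mult_binomials:
  assumes "m \<le> k"
  shows "(\<Sum>i\<le>k. Suc i * (Suc l choose Suc i) * (Suc k choose Suc i) * (i choose m)) =
         Suc l * (l choose m) * ((k + l + 1 - m) choose (k - m))"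
proof -
  obtain e where k: "k = m + e"
    using assms le_Suc_ex by blast
  have "(\<Sum>i\<le>k. Suc i * (Suc l choose Suc i) * (Suc k choose Suc i) * (i choose m)) =
        (\<Sum>i\<in>{m..m + e}. Suc i * (Suc l choose Suc i) * (Suc k choose Suc i) * (i choose m))"
    using k by (intro sum.mono_neutral_right) (auto simp: not_le binomial_eq_0 simp del: binomial_Suc_Suc)
  also have "\<dots> = (\<Sum>p\<le>e. Suc (m + p) * (Suc l choose Suc (m + p)) * (Suc k choose Suc (m + p)) * ((m + p) choose m))"
    by (rule sum.reindex_bij_witness[of _ "\<lambda>p. m + p" "\<lambda>i. i - m"]) (auto simp del: binomial_Suc_Suc)
  also have "\<dots> = (\<Sum>p\<le>e. Suc l * (l choose m) * (((l - m) choose p) * (Suc k choose (e - p))))"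
  proof (intro sum.cong refl)
    fix p assume p: "p \<in> {..e}"
    have 1: "(l choose (m + p)) * ((m + p) choose m) = (l choose m) * ((l - m) choose p)"
      by (cases "m + p \<le> l") (use choose_mult[of m "m + p" l] in \<open>auto simp: binomial_eq_0\<close>)
    have 2: "Suc k choose Suc (m + p) = (Suc k choose (e - p))"
      using p k binomial_symmetric[of "Suc (m + p)" "Suc k"] by (simp del: binomial_Suc_Suc)
    have "Suc (m + p) * (Suc l choose Suc (m + p)) * (Suc k choose Suc (m + p)) * ((m + p) choose m) =
          Suc l * ((l choose (m + p)) * ((m + p) choose m)) * (Suc k choose (e - p))"
      unfolding Suc_times_binomial 2 by (simp only: mult_ac)
    also have "\<dots> = Suc l * (l choose m) * (((l - m) choose p) * (Suc k choose (e - p)))"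
      unfolding 1 by (simp only: mult_ac)
    finally show "Suc (m + p) * (Suc l choose Suc (m + p)) * (Suc k choose Suc (m + p)) * ((m + p) choose m) =
      Suc l * (l choose m) * (((l - m) choose p) * (Suc k choose (e - p)))" .
  qed
  also have "\<dots> = Suc l * (l choose m) * ((l - m + Suc k) choose e)"
    by (simp only: sum_distrib_left[symmetric] vandermonde)
  \<comment> \<open>For m > l the truncated difference l - m is wrong, but then
    \<open>l choose m\<close> is 0 on both sides.\<close>
  also have "\<dots> = Suc l * (l choose m) * ((k + l + 1 - m) choose (k - m))"
    using k by (cases "m \<le> l") (auto simp: binomial_eq_0 add.commute)
  finally show ?thesis .
qed

lemma pochhammer_minus_of_nat: "pochhammer (- real n) m = (-1) ^ m * fact m * real (n choose m)"
  by (simp add: binomial_gbinomial gbinomial_pochhammer)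

lemma hyp2F1_eq_sum_binomials:
  assumes "0 < r"
  shows "real ((l + k + 1) choose l) * r ^ k *
           hyp2F1 (- real k) (- real l) (- real k - real l - 1) (2 * (r - 1) / r) =
         (\<Sum>i\<le>k. real (Suc i) * real (Suc l choose Suc i) * real (Suc k choose Suc i) *
            (2 - r) ^ i * r ^ (k - i)) / real (Suc k)"
proof -
  \<comment> \<open>Chosen so that 2 - r = z + r and -z / r is the argument of the hypergeometric
    function; expanding \<open>(z + r) ^ i\<close> makes the sum over i accessible to
    \<open>sum_mult_binomials\<close>.\<close>
  define z where "z = 2 * (1 - r)"
  have "(\<Sum>i\<le>k. real (Suc i) * real (Suc l choose Suc i) * real (Suc k choose Suc i) * (2 - r) ^ i * r ^ (k - i)) =
        (\<Sum>i\<le>k. \<Sum>m\<le>k. real (Suc i * (Suc l choose Suc i) * (Suc k choose Suc i) * (i choose m)) * (z ^ m * r ^ (k - m)))"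
  proof (intro sum.cong refl)
    fix i assume i: "i \<in> {..k}"
    have "(2 - r) ^ i * r ^ (k - i) = (\<Sum>m\<le>i. real (i choose m) * z ^ m * r ^ (i - m)) * r ^ (k - i)"
      using binomial_ring[of z r i] by (simp add: z_def)
    also have "\<dots> = (\<Sum>m\<le>i. real (i choose m) * (z ^ m * r ^ (k - m)))"
      using i by (auto simp: sum_distrib_right mult.assoc simp flip: power_add intro!: sum.cong)
    also have "\<dots> = (\<Sum>m\<le>k. real (i choose m) * (z ^ m * r ^ (k - m)))"
      using i by (intro sum.mono_neutral_left) auto
    finally have power: "(2 - r) ^ i * r ^ (k - i) = (\<Sum>m\<le>k. real (i choose m) * (z ^ m * r ^ (k - m)))" .
    show "real (Suc i) * real (Suc l choose Suc i) * real (Suc k choose Suc i) * (2 - r) ^ i * r ^ (k - i) =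
        (\<Sum>m\<le>k. real (Suc i * (Suc l choose Suc i) * (Suc k choose Suc i) * (i choose m)) * (z ^ m * r ^ (k - m)))"
      unfolding mult.assoc power
      by (simp add: sum_distrib_left mult_ac del: binomial_Suc_Suc of_nat_Suc mult_Suc mult_Suc_right)
  qed
  also have "\<dots> = (\<Sum>m\<le>k. real (\<Sum>i\<le>k. Suc i * (Suc l choose Suc i) * (Suc k choose Suc i) * (i choose m)) *
                    (z ^ m * r ^ (k - m)))"
    by (subst sum.swap) (simp only: of_nat_sum sum_distrib_right)
  also have "\<dots> = (\<Sum>m\<le>k. real (Suc l * (l choose m) * ((k + l + 1 - m) choose (k - m))) * (z ^ m * r ^ (k - m)))"
    by (intro sum.cong refl, subst sum_mult_binomials) auto
  \<comment> \<open>Terms with m > l vanish through \<open>l choose m\<close>. What remains is the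
    range of the terminating hypergeometric sum.\<close>
  also have "\<dots> = (\<Sum>m\<in>{0..min k l}. real (Suc l * (l choose m) * ((k + l + 1 - m) choose (k - m))) * (z ^ m * r ^ (k - m)))"
    by (rule sum.mono_neutral_right) (auto simp: binomial_eq_0)
  also have "\<dots> = (\<Sum>m\<in>{0..min k l}. real (Suc k) * (real ((l + k + 1) choose l) * r ^ k *
      (pochhammer (- real k) m * pochhammer (- real l) m
        / pochhammer (- real k - real l - 1) m * (2 * (r - 1) / r) ^ m / fact m)))"
  proof (intro sum.cong refl)
    fix m assume "m \<in> {0..min k l}"
    then have m: "m \<le> k" "m \<le> l" by auto
    have c: "- real k - real l - 1 = - real (k + l + 1)" by simp
    \<comment> \<open>After cancelling \<open>l choose m\<close>, both sides equal (k+l+1)! / (l! m!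
      (k-m)!).\<close>
    have "real (Suc l * (l choose m) * ((k + l + 1 - m) choose (k - m))) * real ((k + l + 1) choose m) =
          real (Suc k) * real ((l + k + 1) choose l) * real (k choose m) * real (l choose m)"
    proof -
      have "k + l + 1 - m - (k - m) = Suc l" "l + k + 1 - l = Suc k" "l + k + 1 = k + l + 1"
        using m by auto
      then have "real ((k + l + 1 - m) choose (k - m)) = fact (k + l + 1 - m) / (fact (k - m) * (real (Suc l) * fact l))"
          "real ((k + l + 1) choose m) = fact (k + l + 1) / (fact m * fact (k + l + 1 - m))"
          "real ((l + k + 1) choose l) = fact (k + l + 1) / (fact l * (real (Suc k) * fact k))"
          "real (k choose m) = fact k / (fact m * fact (k - m))"
        using m binomial_fact[of "k - m" "k + l + 1 - m", where ?'a = real]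
          binomial_fact[of m "k + l + 1", where ?'a = real] binomial_fact[of l "l + k + 1", where ?'a = real]
          binomial_fact[of m k, where ?'a = real]
        by (simp_all only: fact_Suc of_nat_mult)
      then show ?thesis
        by (simp only: of_nat_mult) (simp add: field_simps del: of_nat_Suc fact_Suc)
    qed
    moreover have "real ((k + l + 1) choose m) \<noteq> 0" using m by simp
    ultimately have b: "real (Suc l * (l choose m) * ((k + l + 1 - m) choose (k - m))) =
       real (Suc k) * real ((l + k + 1) choose l) * real (k choose m) * real (l choose m) / real ((k + l + 1) choose m)"
      by (simp only: nonzero_eq_divide_eq not_False_eq_True)
    have "r ^ (k - m) = r ^ k / r ^ m"
      using m assms by (simp add: power_diff)
    \<comment> \<open>The three Pochhammer symbols leave one net sign \<open>(-1) ^ m\<close>, which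
      accounts for 2(r - 1) in place of z.\<close>
    moreover have "z ^ m = (2 * (r - 1)) ^ m / (-1) ^ m"
      by (simp add: z_def flip: power_divide)
    ultimately show "real (Suc l * (l choose m) * ((k + l + 1 - m) choose (k - m))) * (z ^ m * r ^ (k - m)) =
      real (Suc k) * (real ((l + k + 1) choose l) * r ^ k *
      (pochhammer (- real k) m * pochhammer (- real l) m
        / pochhammer (- real k - real l - 1) m * (2 * (r - 1) / r) ^ m / fact m))"
      unfolding b c pochhammer_minus_of_nat power_divide by (simp add: mult_ac)
  qed
  also have "\<dots> = real (Suc k) * (real ((l + k + 1) choose l) * r ^ k *
           hyp2F1 (- real k) (- real l) (- real k - real l - 1) (2 * (r - 1) / r))"
    unfolding hyp2F1_terminating by (simp only: sum_distrib_left)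
  finally show ?thesis
    by (simp add: field_simps)
qed

section \<open>The Hankel transform of the Laguerre polynomials\<close>

text \<open>The entire function that agrees with J_1(2 sqrt y) / sqrt y for y > 0. Without square
  roots the kernel of \<open>N_op\<close> is a power series that can be integrated termwise.\<close>

definition bessel_clifford :: "real \<Rightarrow> real" where
  "bessel_clifford y = (\<Sum>j. (-1) ^ j / (fact j * fact (Suc j)) * y ^ j)"

lemma summable_bessel_clifford:
  "summable (\<lambda>j. norm ((-1) ^ j / (fact j * fact (Suc j)) * (y :: real) ^ j))"
proof (rule summable_comparison_test')
  show "summable (\<lambda>j. \<bar>y\<bar> ^ j / fact j)"
    using summable_exp[of "\<bar>y\<bar>"] by (simp add: field_simps)
  show "norm (norm ((-1) ^ j / (fact j * fact (Suc j)) * y ^ j)) \<le> \<bar>y\<bar> ^ j / fact j" for j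
  proof -
    have "\<bar>y\<bar> ^ j / (fact j * fact (Suc j)) \<le> \<bar>y\<bar> ^ j / (fact j * 1)"
      by (intro divide_left_mono mult_left_mono fact_ge_1) auto
    then show ?thesis by (simp add: abs_mult power_abs del: fact_Suc)
  qed
qed

text \<open>Each odd power of sqrt y splits as \<open>sqrt y * y ^ j\<close>. At y = 0 the
  convention 1 / 0 = 0 would make the left side 0, while the series has value 1.\<close>

lemma bessel_J_1_sqrt:
  assumes "0 < y"
  shows "bessel_J 1 (2 * sqrt y) * sqrt (1 / y) = bessel_clifford y"
proof -
  have "(-1) ^ j / (fact j * fact (j + 1)) * (2 * sqrt y / 2) ^ (2 * j + 1) =
        sqrt y * ((-1) ^ j / (fact j * fact (Suc j)) * y ^ j)" for j
    using assms by (simp add: power_mult del: fact_Suc)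
  then have "bessel_J 1 (2 * sqrt y) = sqrt y * bessel_clifford y"
    unfolding bessel_J_def bessel_clifford_def
    by (simp only: suminf_mult[OF summable_norm_cancel[OF summable_bessel_clifford]])
  then show ?thesis
    using assms by (simp add: real_sqrt_divide)
qed

text \<open>Series and integral may be interchanged because the integrals of the absolute values are
  summable: they are \<open>\<bar>x\<bar> ^ j / fact j\<close> times a binomial coefficient and a
  constant.\<close>

lemma
  fixes x :: real
  shows integrable_bessel_clifford_mult_power:
      "integrable m_measure (\<lambda>s. bessel_clifford (s * x) * s ^ i)"
    and sums_bessel_clifford_mult_power:
      "(\<lambda>j. (-1) ^ j / (fact j * fact (Suc j)) * x ^ j * (\<integral>s. s ^ (j + i) \<partial>m_measure)) sums
       (\<integral>s. bessel_clifford (s * x) * s ^ i \<partial>m_measure)"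
proof -
  define f where "f j s = (-1) ^ j / (fact j * fact (Suc j)) * x ^ j * s ^ (j + i)" for j and s :: real
  have f: "f j s = (-1) ^ j / (fact j * fact (Suc j)) * (s * x) ^ j * s ^ i" for j s
    by (simp add: f_def power_add power_mult_distrib mult_ac del: fact_Suc)
  have integrable: "integrable m_measure (f j)" for j
    unfolding f_def by (auto simp del: fact_Suc)
  have "summable (\<lambda>j. norm (f j s))" for s
    unfolding f norm_mult[of _ "s ^ i"] by (intro summable_mult2 summable_bessel_clifford)
  then have summable: "AE s in m_measure. summable (\<lambda>j. norm (f j s))"
    by simp
  have norm_integral: "(\<integral>s. norm (f j s) \<partial>m_measure) = \<bar>x\<bar> ^ j / fact j * (fact i * real (Suc (j + i) choose i))" for j
  proof -
    have "(\<integral>s. norm (f j s) \<partial>m_measure) = (\<integral>s. \<bar>x\<bar> ^ j / (fact j * fact (Suc j)) * s ^ (j + i) \<partial>m_measure)"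
      by (intro Bochner_Integration.integral_cong) (auto simp: f_def abs_mult power_abs simp del: fact_Suc)
    also have "\<dots> = \<bar>x\<bar> ^ j / (fact j * fact (Suc j)) * fact (Suc (j + i))"
      by (simp add: integral_m_measure_power del: fact_Suc)
    also have "\<dots> = \<bar>x\<bar> ^ j / fact j * (fact i * real (Suc (j + i) choose i))"
      using binomial_fact[of i "Suc (j + i)", where ?'a = real] by (simp add: field_simps del: fact_Suc)
    finally show ?thesis .
  qed
  have sums: "summable (\<lambda>j. \<integral>s. norm (f j s) \<partial>m_measure)"
  proof (rule summable_comparison_test')
    \<comment> \<open>The bound \<open>2 ^ Suc (j + i)\<close> for the binomial coefficient only
      changes \<bar>x\<bar> to 2\<bar>x\<bar>, leaving a multiple of an exponential series.\<close>
    show "summable (\<lambda>j. fact i * 2 ^ Suc i * (inverse (fact j) * (2 * \<bar>x\<bar>) ^ j))"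
      by (intro summable_mult summable_exp)
    show "norm (\<integral>s. norm (f j s) \<partial>m_measure) \<le> fact i * 2 ^ Suc i * (inverse (fact j) * (2 * \<bar>x\<bar>) ^ j)" for j
    proof -
      have "real (Suc (j + i) choose i) \<le> 2 ^ Suc (j + i)"
        using of_nat_mono[OF binomial_le_pow2[of "Suc (j + i)" i], where ?'a = real] by simp
      then have "\<bar>x\<bar> ^ j / fact j * (fact i * real (Suc (j + i) choose i)) \<le> \<bar>x\<bar> ^ j / fact j * (fact i * 2 ^ Suc (j + i))"
        by (intro mult_left_mono) auto
      then show ?thesis
        unfolding norm_integral by (simp add: power_add power_mult_distrib field_simps del: binomial_Suc_Suc)
    qed
  qed
  have suminf: "(\<Sum>j. f j s) = bessel_clifford (s * x) * s ^ i" for s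
    unfolding f bessel_clifford_def
    by (rule suminf_mult2[symmetric]) (rule summable_norm_cancel[OF summable_bessel_clifford])
  show "integrable m_measure (\<lambda>s. bessel_clifford (s * x) * s ^ i)"
    using integrable_suminf[OF integrable summable sums] by (simp only: suminf)
  show "(\<lambda>j. (-1) ^ j / (fact j * fact (Suc j)) * x ^ j * (\<integral>s. s ^ (j + i) \<partial>m_measure)) sums
        (\<integral>s. bessel_clifford (s * x) * s ^ i \<partial>m_measure)"
    using sums_integral[OF integrable summable sums] by (simp only: suminf) (simp add: f_def del: fact_Suc)
qed

text \<open>Termwise integration reduces this to the moments of \<open>laguerre n\<close>. Those of
  order below n vanish, and the remaining ones turn the kernel into the exponential series
  multiplied by \<open>x ^ n / fact n\<close>.\<close>

lemma integral_bessel_clifford_mult_laguerre: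
  "(\<integral>s. bessel_clifford (s * x) * laguerre n s \<partial>m_measure) = exp (- x) * x ^ n / fact n"
proof -
  define c where "c m = real (Suc n choose Suc m) * (-1) ^ m / fact m" for m
  define a where "a j = (-1) ^ j / (fact j * fact (Suc j)) * x ^ j" for j
  have laguerre: "laguerre n s = (\<Sum>m\<le>n. c m * s ^ m)" for s
    using power_mult_laguerre_expand[of s 0 n] by (simp add: c_def)
  have "(\<lambda>j. \<Sum>m\<le>n. c m * (a j * (\<integral>s. s ^ (j + m) \<partial>m_measure))) sums
        (\<Sum>m\<le>n. c m * (\<integral>s. bessel_clifford (s * x) * s ^ m \<partial>m_measure))"
    unfolding a_def by (intro sums_sum sums_mult sums_bessel_clifford_mult_power)
  also have "(\<lambda>j. \<Sum>m\<le>n. c m * (a j * (\<integral>s. s ^ (j + m) \<partial>m_measure))) =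
             (\<lambda>j. a j * (\<integral>s. s ^ j * laguerre n s \<partial>m_measure))"
    unfolding laguerre by (simp add: sum_distrib_left power_add mult_ac flip: power_add)
  also have "(\<Sum>m\<le>n. c m * (\<integral>s. bessel_clifford (s * x) * s ^ m \<partial>m_measure)) =
             (\<integral>s. bessel_clifford (s * x) * laguerre n s \<partial>m_measure)"
    unfolding laguerre
    by (simp add: sum_distrib_left mult.left_commute integrable_bessel_clifford_mult_power)
  finally have "(\<lambda>j. a j * (\<integral>s. s ^ j * laguerre n s \<partial>m_measure)) sums
    (\<integral>s. bessel_clifford (s * x) * laguerre n s \<partial>m_measure)" .
  moreover have "(\<lambda>j. a j * (\<integral>s. s ^ j * laguerre n s \<partial>m_measure)) sums (exp (- x) * x ^ n / fact n)"
  \<comment> \<open>The first n terms are zero, so the series is reindexed by j = d + n.\<close>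
  proof (subst sums_zero_iff_shift[symmetric])
    show "a j * (\<integral>s. s ^ j * laguerre n s \<partial>m_measure) = 0" if "j < n" for j
      using that by (simp add: integral_power_mult_laguerre binomial_eq_0 del: binomial_Suc_Suc)
    have "a (d + n) * (\<integral>s. s ^ (d + n) * laguerre n s \<partial>m_measure) = x ^ n / fact n * ((- x) ^ d /\<^sub>R fact d)" for d
    proof -
      have "real (Suc (d + n) choose Suc n) = fact (Suc (d + n)) / (real (Suc n) * fact n * fact d)"
        using binomial_fact[of "Suc n" "Suc (d + n)", where ?'a = real] by (simp del: binomial_Suc_Suc)
      then show ?thesis
        unfolding integral_power_mult_laguerre a_def
        by (simp add: power_add power_minus[of x] field_simps del: binomial_Suc_Suc fact_Suc of_nat_Suc)
    qed
    then show "(\<lambda>d. a (d + n) * (\<integral>s. s ^ (d + n) * laguerre n s \<partial>m_measure)) sums (exp (- x) * x ^ n / fact n)"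
      using sums_mult[OF exp_converges[of "- x"], of "x ^ n / fact n"] by (simp add: mult.commute)
  qed
  ultimately show ?thesis
    by (rule sums_unique2)
qed

section \<open>The operator on Laguerre polynomials and its matrix coefficients\<close>

text \<open>The factor exp(-t/\<rho>) from the Hankel transform lowers the exponent (1-r)/\<rho> in
  \<open>N_op\<close> to -r/\<rho>, the one in \<open>M_op\<close>, so both parts share one
  exponential.\<close>

lemma P_op_laguerre_e:
  assumes "r < 1" "0 < t"
  shows "P_op r (laguerre_e n) t =
    complex_of_real (exp (- (r / (2 - r)) * t) / (2 - r) *
      (laguerre n (t / (2 - r)) + (t / (2 - r)) ^ n / fact n))"
proof -
  define \<rho> where "\<rho> = 2 - r"
  have \<rho>: "0 < \<rho>" using assms by (simp add: \<rho>_def)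
  have "(\<integral>s. complex_of_real (bessel_J 1 (2 * sqrt (s * t / \<rho>)) * sqrt (\<rho> / (s * t))) * laguerre_e n s \<partial>m_measure) =
        (\<integral>s. complex_of_real (bessel_clifford (s * (t / \<rho>)) * laguerre n s) \<partial>m_measure)"
  proof (intro Bochner_Integration.integral_cong refl)
    fix s assume "s \<in> space m_measure"
    then show "complex_of_real (bessel_J 1 (2 * sqrt (s * t / \<rho>)) * sqrt (\<rho> / (s * t))) * laguerre_e n s =
      complex_of_real (bessel_clifford (s * (t / \<rho>)) * laguerre n s)"
      using bessel_J_1_sqrt[of "s * t / \<rho>"] assms \<rho> by (simp add: laguerre_e_eq)
  qed
  also have "\<dots> = complex_of_real (exp (- (t / \<rho>)) * (t / \<rho>) ^ n / fact n)"
    by (simp only: integral_complex_of_real integral_bessel_clifford_mult_laguerre)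
  finally have "N_op r (laguerre_e n) t =
    complex_of_real (1 / \<rho> * exp ((1 - r) / \<rho> * t)) *
    complex_of_real (exp (- (t / \<rho>)) * (t / \<rho>) ^ n / fact n)"
    unfolding N_op_def Let_def \<rho>_def[symmetric] by (rule arg_cong)
  also have "\<dots> =
    complex_of_real (1 / \<rho> * (exp ((1 - r) / \<rho> * t) * exp (- (t / \<rho>))) * (t / \<rho>) ^ n / fact n)"
    by simp
  also have "exp ((1 - r) / \<rho> * t) * exp (- (t / \<rho>)) = exp (- (r / \<rho>) * t)"
    using \<rho> by (simp add: field_simps flip: exp_add)
  finally show ?thesis
    unfolding P_op_def M_op_def Let_def \<rho>_def[symmetric] laguerre_e_eq[of n "t / \<rho>"]
    by (simp add: algebra_simps)
qed

lemma borel_measurable_laguerre [measurable]: "laguerre n \<in> borel_measurable borel"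
  unfolding laguerre_def[abs_def] by measurable

text \<open>The single \<open>I n\<close> comes from \<open>M_op\<close>, the alternating sum from
  \<open>N_op\<close> after expanding its monomial in Laguerre polynomials.\<close>

lemma a_coeff_eq_sum:
  fixes r :: real and k n :: nat
  assumes "0 < r" "r < 1"
  defines "I \<equiv> \<lambda>l. \<integral>v. laguerre l (1 / 2 * v) * laguerre k ((2 - r) / 2 * v) \<partial>m_measure"
  shows "a_coeff r k n = complex_of_real
    ((2 - r) / (4 * real (Suc k)) * (I n + (\<Sum>l\<le>n. (-1) ^ l * real (Suc n choose Suc l) * I l)))"
proof -
  define \<rho> where "\<rho> = 2 - r"
  have \<rho>: "0 < \<rho>" using assms by (simp add: \<rho>_def)
  define X where "X = I n + (\<Sum>l\<le>n. (-1) ^ l * real (Suc n choose Suc l) * I l)"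
  \<comment> \<open>The integrand in the variable v = 2t/\<rho>, without its exponential. Since 1 -
    2/\<rho> = -r/\<rho>, the exponential is exactly the one absorbed by
    \<open>integral_m_measure_dilate\<close> with a = 2/\<rho>.\<close>
  define f where "f v = 1 / \<rho> * ((laguerre n (1 / 2 * v) + (1 / 2 * v) ^ n / fact n) * laguerre k (\<rho> / 2 * v))" for v
  have [measurable]: "f \<in> borel_measurable borel"
    unfolding f_def[abs_def] by measurable
  have "m_inner (P_op r (laguerre_e n)) (laguerre_e k) =
        (\<integral>t. complex_of_real (exp ((1 - 2 / \<rho>) * t) * f (2 / \<rho> * t)) \<partial>m_measure)"
    unfolding m_inner_def
  proof (intro Bochner_Integration.integral_cong refl)
    fix t assume t: "t \<in> space m_measure"
    have "1 - 2 / \<rho> = - (r / \<rho>)" using \<rho> by (simp add: \<rho>_def field_simps)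
    then show "P_op r (laguerre_e n) t * cnj (laguerre_e k t) =
       complex_of_real (exp ((1 - 2 / \<rho>) * t) * f (2 / \<rho> * t))"
      using t assms \<rho> P_op_laguerre_e[of r t n, folded \<rho>_def] by (simp add: f_def laguerre_e_eq)
  qed
  also have "\<dots> = complex_of_real ((\<integral>v. f v \<partial>m_measure) / (2 / \<rho>)\<^sup>2)"
    unfolding integral_complex_of_real using \<rho> by (subst integral_m_measure_dilate) auto
  also have "(\<integral>v. f v \<partial>m_measure) = 1 / \<rho> * X"
  proof -
    have "f v = 1 / \<rho> * (laguerre n (1 / 2 * v) * laguerre k (\<rho> / 2 * v) +
      (\<Sum>l\<le>n. (-1) ^ l * real (Suc n choose Suc l) * (laguerre l (1 / 2 * v) * laguerre k (\<rho> / 2 * v))))" for v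
      unfolding f_def power_eq_sum_laguerre
      by (simp only: distrib_right sum_distrib_right mult.assoc)
    then have "(\<integral>v. f v \<partial>m_measure) = (\<integral>v. 1 / \<rho> * (laguerre n (1 / 2 * v) * laguerre k (\<rho> / 2 * v) +
      (\<Sum>l\<le>n. (-1) ^ l * real (Suc n choose Suc l) * (laguerre l (1 / 2 * v) * laguerre k (\<rho> / 2 * v)))) \<partial>m_measure)"
      by simp
    also have "\<dots> = 1 / \<rho> * X"
      unfolding X_def I_def \<rho>_def[symmetric]
      by (simp only: integral_mult_right_zero Bochner_Integration.integral_add Bochner_Integration.integral_sum
        integrable_laguerre_dilate_mult_laguerre_dilate integrable_mult_right Bochner_Integration.integrable_sum)
    finally show ?thesis .
  qed
  also have "1 / \<rho> * X / (2 / \<rho>)\<^sup>2 = \<rho> / 4 * X"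
    using \<rho> by (simp add: power2_eq_square)
  finally have "m_inner (P_op r (laguerre_e n)) (laguerre_e k) = complex_of_real (\<rho> / 4 * X)" .
  then have "a_coeff r k n = complex_of_real (\<rho> / (4 * real (Suc k)) * X)"
    unfolding a_coeff_def by (simp only:) (simp add: distrib_left mult.commute add.commute)
  then show ?thesis
    unfolding \<rho>_def X_def .
qed

text \<open>With a = 1/2 and b = (2-r)/2 one has ab = (2-r)/4, 1-a = 1/2 and 1-b = r/2, so every
  term carries the same power of 2 and the sum is that of
  \<open>hyp2F1_eq_sum_binomials\<close>.\<close>

lemma integral_laguerre_half_mult_laguerre_eq_hyp2F1:
  assumes "0 < r"
  shows "(2 - r) / (4 * real (Suc k)) * (\<integral>v. laguerre l (1 / 2 * v) * laguerre k ((2 - r) / 2 * v) \<partial>m_measure) =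
    real ((l + k + 1) choose l) * ((2 - r) * r ^ k / 2 ^ (l + k + 2)) *
       hyp2F1 (- real k) (- real l) (- real k - real l - 1) (2 * (r - 1) / r)"
proof -
  have "(\<integral>v. laguerre l (1 / 2 * v) * laguerre k ((2 - r) / 2 * v) \<partial>m_measure) =
    (\<Sum>i\<le>k. real (Suc i) * real (Suc l choose Suc i) * real (Suc k choose Suc i) * (2 - r) ^ i * r ^ (k - i) /
      2 ^ (l + k))"
    unfolding integral_laguerre_dilate_mult_laguerre_dilate
  proof (intro sum.cong refl)
    fix i assume i: "i \<in> {..k}"
    show "real (Suc i) * real (Suc l choose Suc i) * real (Suc k choose Suc i) *
        (1 / 2 * ((2 - r) / 2)) ^ i * (1 - 1 / 2) ^ (l - i) * (1 - (2 - r) / 2) ^ (k - i) =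
      real (Suc i) * real (Suc l choose Suc i) * real (Suc k choose Suc i) * (2 - r) ^ i * r ^ (k - i) / 2 ^ (l + k)"
    \<comment> \<open>Counting powers of 2 relies on a genuine difference l - i; for i > l the
      binomial makes both sides 0.\<close>
    proof (cases "i \<le> l")
      case True
      have "1 / 2 * ((2 - r) / 2) = (2 - r) / (2 * 2)"
        by simp
      then have "(1 / 2 * ((2 - r) / 2)) ^ i = (2 - r) ^ i / (2 ^ i * 2 ^ i)"
        by (simp only: power_divide power_mult_distrib)
      moreover have "(1 - 1 / 2 :: real) ^ (l - i) = 1 / 2 ^ (l - i)"
        "(1 - (2 - r) / 2) ^ (k - i) = r ^ (k - i) / 2 ^ (k - i)"
        by (simp_all add: diff_divide_distrib power_divide)
      moreover have "(2 :: real) ^ (l + k) = (2 ^ i * 2 ^ i) * (2 ^ (l - i) * 2 ^ (k - i))"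
        using i True by (simp flip: power_add)
      ultimately show ?thesis
        by (simp only: times_divide_eq_right times_divide_eq_left divide_divide_eq_left mult_1_right mult.assoc)
    qed (simp add: binomial_eq_0 del: binomial_Suc_Suc)
  qed
  also have "\<dots> = real (Suc k) * (real ((l + k + 1) choose l) * r ^ k *
       hyp2F1 (- real k) (- real l) (- real k - real l - 1) (2 * (r - 1) / r)) / 2 ^ (l + k)"
    unfolding hyp2F1_eq_sum_binomials[OF assms] by (simp del: binomial_Suc_Suc of_nat_Suc flip: sum_divide_distrib)
  finally show ?thesis
    by (simp add: power_add del: of_nat_Suc binomial_Suc_Suc)
qed

theorem proposition3p1:
  fixes r :: real and k n :: nat
  assumes "0 < r" and "r < 1"
  shows "a_coeff r k n = complex_of_real
    (real ((n + k + 1) choose n) * ((2 - r) * r ^ k / 2 ^ (n + k + 2)) *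
       hyp2F1 (- real k) (- real n) (- real k - real n - 1) (2 * (r - 1) / r)
     + (\<Sum>l=0..n. (- 1) ^ l * real ((n + 1) choose (n - l)) * real ((l + k + 1) choose l) *
          ((2 - r) * r ^ k / 2 ^ (l + k + 2)) *
          hyp2F1 (- real k) (- real l) (- real k - real l - 1) (2 * (r - 1) / r)))"
proof -
  define H where "H l = real ((l + k + 1) choose l) * ((2 - r) * r ^ k / 2 ^ (l + k + 2)) *
       hyp2F1 (- real k) (- real l) (- real k - real l - 1) (2 * (r - 1) / r)" for l
  define I where "I l = (\<integral>v. laguerre l (1 / 2 * v) * laguerre k ((2 - r) / 2 * v) \<partial>m_measure)" for l
  define C where "C = (2 - r) / (4 * real (Suc k))"
  \<comment> \<open>One identity serves both parts of the formula: l = n gives the first term, l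
    \<le> n the sum.\<close>
  have H: "C * I l = H l" for l
    unfolding H_def I_def C_def by (rule integral_laguerre_half_mult_laguerre_eq_hyp2F1) fact
  have binomial: "(n + 1 choose (n - l)) = (Suc n choose Suc l)" if "l \<le> n" for l
    using that binomial_symmetric[of "Suc l" "Suc n"] by (simp del: binomial_Suc_Suc)
  have "a_coeff r k n = complex_of_real (C * (I n + (\<Sum>l\<le>n. (-1) ^ l * real (Suc n choose Suc l) * I l)))"
    using a_coeff_eq_sum[OF assms] by (simp only: I_def C_def)
  also have "C * (I n + (\<Sum>l\<le>n. (-1) ^ l * real (Suc n choose Suc l) * I l)) =
    C * I n + (\<Sum>l\<le>n. (-1) ^ l * real (Suc n choose Suc l) * (C * I l))"
    by (simp add: distrib_left sum_distrib_left mult_ac del: binomial_Suc_Suc)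
  also have "\<dots> = H n + (\<Sum>l=0..n. (-1) ^ l * real ((n + 1) choose (n - l)) * H l)"
    unfolding H atMost_atLeast0
    by (intro arg_cong2[where f = "(+)"] sum.cong refl) (simp_all only: binomial atLeastAtMost_iff)
  finally show ?thesis
    by (simp only: H_def mult.assoc)
qed

end
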